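(* Let $(X,\|\cdot\|,\succcurlyeq)$ be a regular partially ordered Banach space. Let $D$ be a closed inductive subset of $X$. Let $T: D\to 2^D\setminus\{\emptyset\}$ be a set-valued isotone mapping such that, for every $x\in D$, the value $Tx$ is universally inductive in $(D,\succcurlyeq)$. Suppose that there are points $x_0\in D$ and $x_1\in Tx_0$ satisfying $x_0\preccurlyeq x_1$. Let $\mathcal{F}(T)=\{x\in D: x\in Tx\}$ be the set of fixed points of $T$. Then (a) $\mathcal{F}(T)$ is a nonempty inductive subset of $D$; (b) $\mathcal{F}(T)\cap[x_0)$ is a nonempty inductive subset of $D$.
   Context: For a partial order $\succcurlyeq$ on $X$ write $[u)=\{x\in X: x\succcurlyeq u\}$ and $(w]=\{x\in X: x\preccurlyeq w\}$. A partially ordered Banach space $(X,\|\cdot\|,\succcurlyeq)$ is a real Banach space $X$ with a partial order $\succcurlyeq$ such that: (1) $x\succcurlyeq y$ implies $x+z\succcurlyeq y+z$ for all $x,y,z\in X$; (2) $x\succcurlyeq y$ implies $\alpha x\succcurlyeq\alpha y$ for all $x,y\in X$ and $\alpha\ge 0$; (3) there are distinct $x,y\in X$ with $x\succcurlyeq y$; and for every $u\in X$ the sets $[u)$ and $(u]$ are norm-closed. It is called regular if every $\succcurlyeq$-increasing sequence that has a $\succcurlyeq$-upper bound in $X$ is norm-convergent, i.e. $x_1\preccurlyeq x_2\preccurlyeq\cdots\preccurlyeq y$ for some $y\in X$ implies that there is $x\in X$ with $\|x_n-x\|\to 0$. A chain is a nonempty totally ordered subset. A subset $A\subseteq X$ is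 inductive if every chain in $A$ has a $\succcurlyeq$-upper bound belonging to $A$. Closed means norm-closed. A set-valued mapping $T: D\to 2^D\setminus\{\emptyset\}$ is isotone (order-increasing upward) if $x\preccurlyeq y$ in $D$ implies that for every $z\in Tx$ there is $w\in Ty$ with $z\preccurlyeq w$. A nonempty subset $A$ of a poset $(P,\succcurlyeq)$ is universally inductive in $P$ if every chain $\{x_\alpha\}\subseteq P$ such that each element $x_\beta$ of the chain has a $\succcurlyeq$-upper cover in $A$ (i.e. some $a\in A$ with $x_\beta\preccurlyeq a$) has a $\succcurlyeq$-upper bound in $A$. *)

theory Defs
  imports "HOL-Analysis.Analysis"
begin

(* Translation invariance and monotonicity of scaling by nonnegative reals come from
   ordered_real_vector. The order intervals [u) and (u] are {u..} and {..u}. *)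
class partially_ordered_banach = banach + ordered_real_vector +
  assumes order_nontrivial: "\<exists>x y. x \<noteq> y \<and> y \<le> x"
    and closed_upper_set: "closed {u..}"
    and closed_lower_set: "closed {..u}"

class regular_partially_ordered_banach = partially_ordered_banach +
  assumes regular: "(\<And>n::nat. x n \<le> x (Suc n)) \<Longrightarrow> (\<And>n. x n \<le> y) \<Longrightarrow> convergent x"

(* The library's chain predicate also holds of the empty set. *)
definition nonempty_chain :: "'a::order set \<Rightarrow> bool" where
  "nonempty_chain C \<longleftrightarrow> C \<noteq> {} \<and> Complete_Partial_Order.chain (\<le>) C"

definition inductive_subset :: "'a::order set \<Rightarrow> bool" where
  "inductive_subset A \<longleftrightarrow>
     (\<forall>C. nonempty_chain C \<and> C \<subseteq> A \<longrightarrow> (\<exists>a\<in>A. \<forall>c\<in>C. c \<le> a))"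

definition universally_inductive_in :: "'a::order set \<Rightarrow> 'a set \<Rightarrow> bool" where
  "universally_inductive_in P A \<longleftrightarrow>
     A \<noteq> {} \<and> A \<subseteq> P \<and>
     (\<forall>C. nonempty_chain C \<and> C \<subseteq> P \<and> (\<forall>c\<in>C. \<exists>a\<in>A. c \<le> a)
        \<longrightarrow> (\<exists>a\<in>A. \<forall>c\<in>C. c \<le> a))"

definition set_valued_self_map :: "'a set \<Rightarrow> ('a \<Rightarrow> 'a set) \<Rightarrow> bool" where
  "set_valued_self_map D T \<longleftrightarrow> (\<forall>x\<in>D. T x \<subseteq> D \<and> T x \<noteq> {})"

definition isotone_on :: "'a::order set \<Rightarrow> ('a \<Rightarrow> 'a set) \<Rightarrow> bool" where
  "isotone_on D T \<longleftrightarrow>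
     (\<forall>x\<in>D. \<forall>y\<in>D. x \<le> y \<longrightarrow> (\<forall>z\<in>T x. \<exists>w\<in>T y. z \<le> w))"

definition fixed_points :: "'a set \<Rightarrow> ('a \<Rightarrow> 'a set) \<Rightarrow> 'a set" where
  "fixed_points D T = {x\<in>D. x \<in> T x}"

end

theory Submission
  imports Defs
begin

text \<open>
  Regularity makes a bounded chain a Cauchy net: otherwise one could climb along it by steps of a
  fixed positive length, producing a bounded increasing sequence that does not converge. Hence
  every bounded chain has a least upper bound, and it lies in the closure of the chain. For a chain
  of points lying below some point of their own image, isotonicity and universal inductivity bound
  the chain by some point of the image of its supremum, so the supremum also lies below a point of
  its image. Zorn's lemma then gives maximal points of this kind, and isotonicity forces them to be
  fixed points.
\<close>

lemma nonempty_chain_total: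
  assumes "nonempty_chain C" "x \<in> C" "y \<in> C"
  shows "x \<le> y \<or> y \<le> x"
  using assms by (auto simp: nonempty_chain_def Complete_Partial_Order.chain_def)

text \<open>This is the Cauchy property of the chain as a net: by the triangle inequality, any two
  elements of \<open>C\<close> above \<open>c\<close> are less than \<open>2 * e\<close>
  apart.\<close>

lemma bounded_chain_eventually_small:
  fixes C :: "'a::regular_partially_ordered_banach set"
  assumes C: "nonempty_chain C" and b: "\<And>c. c \<in> C \<Longrightarrow> c \<le> b" and e: "0 < (e::real)"
  obtains c where "c \<in> C" "\<And>d. d \<in> C \<Longrightarrow> c \<le> d \<Longrightarrow> dist c d < e"
proof -
  have "\<exists>c\<in>C. \<forall>d\<in>C. c \<le> d \<longrightarrow> dist c d < e"
  proof (rule ccontr)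
    assume "\<not> ?thesis"
    then have step: "\<exists>d. d \<in> C \<and> c \<le> d \<and> e \<le> dist c d" if "c \<in> C" for c
      using that by (meson not_le)
    have "\<exists>x. \<forall>n::nat. x n \<in> C \<and> x n \<le> x (Suc n) \<and> e \<le> dist (x n) (x (Suc n))"
      by (rule dependent_nat_choice) (use C step in \<open>auto simp: nonempty_chain_def\<close>)
    then obtain x :: "nat \<Rightarrow> 'a" where x: "\<And>n. x n \<in> C" "\<And>n. x n \<le> x (Suc n)"
      "\<And>n. e \<le> dist (x n) (x (Suc n))" by blast
    have "convergent x" by (rule regular[of x b]) (use x b in auto)
    then obtain N where "\<And>m n. m \<ge> N \<Longrightarrow> n \<ge> N \<Longrightarrow> dist (x m) (x n) < e"
      using e by (meson convergent_Cauchy metric_CauchyD)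
    \<comment> \<open>\<open>N\<close> and \<open>Suc N\<close> both lie in the Cauchy tail, yet
      consecutive terms are at least \<open>e\<close> apart.\<close>
    then show False using x(3)[of N] by (meson le_SucI not_le order_refl)
  qed
  then show ?thesis using that by blast
qed

text \<open>The supremum is the limit of an increasing sequence in \<open>C\<close> whose tails
  shrink. The sequence need not be cofinal, but a chain element above all its terms must equal the
  limit. Leastness holds because the sets \<open>{..w}\<close> are closed.\<close>

lemma bounded_chain_has_supremum:
  fixes C :: "'a::regular_partially_ordered_banach set"
  assumes C: "nonempty_chain C" and b: "\<And>c. c \<in> C \<Longrightarrow> c \<le> b"
  obtains u where "u \<in> closure C" "\<And>c. c \<in> C \<Longrightarrow> c \<le> u"
    "\<And>w. (\<And>c. c \<in> C \<Longrightarrow> c \<le> w) \<Longrightarrow> u \<le> w"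
proof -
  \<comment> \<open>With \<open>n\<close> in place of \<open>Suc n\<close>, the radius at 0 would be
    \<open>inverse 0 = 0\<close>, and no \<open>c\<close> would qualify.\<close>
  define small where
    "small n c \<longleftrightarrow> c \<in> C \<and> (\<forall>d\<in>C. c \<le> d \<longrightarrow> dist c d < inverse (real (Suc n)))" for n c
  have start: "\<exists>c. small n c" for n
    using bounded_chain_eventually_small[OF C b, of "inverse (real (Suc n))"]
    unfolding small_def by (metis inverse_positive_iff_positive of_nat_0_less_iff zero_less_Suc)
  have step: "\<exists>c'. small (Suc n) c' \<and> c \<le> c'" if "small n c" for n c
  proof -
    define e where "e = inverse (real (Suc (Suc n)))"
    \<comment> \<open>Half the radius, because the centre will move from \<open>d\<close> to
      \<open>c'\<close>, which costs another \<open>e / 2\<close>.\<close>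
    have "0 < e / 2" by (simp add: e_def)
    then obtain d where d: "d \<in> C" "\<And>y. y \<in> C \<Longrightarrow> d \<le> y \<Longrightarrow> dist d y < e / 2"
      using bounded_chain_eventually_small[OF C b] by blast
    have "c \<in> C" using that by (simp add: small_def)
    \<comment> \<open>\<open>c'\<close> is the larger of \<open>c\<close> and \<open>d\<close>:
      above \<open>c\<close> to keep the sequence increasing, above \<open>d\<close> to inherit its
      small tail.\<close>
    then obtain c' where c': "c' \<in> C" "c \<le> c'" "d \<le> c'"
      using nonempty_chain_total[OF C _ d(1), of c] d(1) by blast
    have "dist c' y < e" if "y \<in> C" "c' \<le> y" for y
    proof -
      have "dist d y < e / 2" "dist d c' < e / 2"
        using d(2) c' that by (auto intro: order_trans)
      then show ?thesis by (metis dist_commute dist_triangle_half_r)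
    qed
    then show ?thesis using c' by (auto simp: small_def e_def)
  qed
  obtain x where x: "\<And>n. small n (x n)" and x_step: "\<And>n. x n \<le> x (Suc n)"
    using dependent_nat_choice[of small "\<lambda>_. (\<le>)"] start step by metis
  have x_in: "x n \<in> C" for n using x by (simp add: small_def)
  have "convergent x" by (rule regular[of x b]) (use x_step x_in b in auto)
  then obtain u where u: "x \<longlonglongrightarrow> u" by (auto simp: convergent_def)
  have x_mono: "x m \<le> x n" if "m \<le> n" for m n
    using lift_Suc_mono_le[of x] x_step that by blast
  have below: "x n \<le> u" for n
  proof -
    \<comment> \<open>Dropping the first \<open>n\<close> terms leaves a sequence inside this closed
      set with the same limit.\<close>
    have "u \<in> {x n..}"
      by (rule closed_sequentially[OF closed_upper_set _ LIMSEQ_ignore_initial_segment[OF u, of n]])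
         (simp add: x_mono)
    then show ?thesis by simp
  qed
  have upper: "c \<le> u" if c: "c \<in> C" for c
  proof (cases "\<exists>n. c \<le> x n")
    case True
    then show ?thesis using below order_trans by blast
  next
    case False
    \<comment> \<open>Now \<open>c\<close> lies in every tail, so its distance to \<open>x n\<close>
      tends to 0 and \<open>c\<close> is the limit \<open>u\<close> itself.\<close>
    then have "x n \<le> c" for n using nonempty_chain_total[OF C c x_in] by blast
    then have "dist (x n) c < inverse (real (Suc n))" for n
      using x[of n] c by (auto simp: small_def)
    then have "\<forall>\<^sub>F n in sequentially. dist (x n) c \<le> inverse (real (Suc n))"
      by (intro always_eventually allI less_imp_le)
    then have "(\<lambda>n. dist (x n) c) \<longlonglongrightarrow> 0"
      by (intro real_tendsto_sandwich[OF _ _ tendsto_const LIMSEQ_inverse_real_of_nat]) simp_all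
    then have "x \<longlonglongrightarrow> c" by (rule iffD2[OF tendsto_dist_iff])
    then show ?thesis using u LIMSEQ_unique by blast
  qed
  have least: "u \<le> w" if "\<And>c. c \<in> C \<Longrightarrow> c \<le> w" for w
    using closed_sequentially[OF closed_lower_set[of w] _ u] that x_in by auto
  have "u \<in> closure C" using x_in u by (auto simp: closure_sequential)
  then show ?thesis using upper least by (rule that)
qed

text \<open>Zorn's lemma is applied to the part of \<open>A\<close> above \<open>u\<close>. A
  maximal element there is maximal in all of \<open>A\<close>, since anything above it is also above
  \<open>u\<close>.\<close>

lemma order_Zorn_above:
  fixes A :: "'a::order set"
  assumes A: "inductive_subset A" and u: "u \<in> A"
  obtains m where "m \<in> A" "u \<le> m" "\<And>a. a \<in> A \<Longrightarrow> m \<le> a \<Longrightarrow> a = m"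
proof -
  let ?B = "A \<inter> {u..}"
  have "\<exists>m\<in>?B. \<forall>a\<in>?B. m \<le> a \<longrightarrow> a = m"
  proof (rule predicate_Zorn)
    show "partial_order_on ?B (relation_of (\<le>) ?B)"
      by (rule partial_order_on_relation_ofI) auto
    fix C assume C: "C \<in> Chains (relation_of (\<le>) ?B)"
    show "\<exists>b\<in>?B. \<forall>a\<in>C. a \<le> b"
    \<comment> \<open>Zorn's lemma also asks for a bound of the empty chain, on which
      \<open>inductive_subset\<close> is silent; \<open>u\<close> serves.\<close>
    proof (cases "C = {}")
      case True
      then show ?thesis using u by auto
    next
      case False
      have C_sub: "C \<subseteq> ?B" using C Chains_relation_of by blast
      have "nonempty_chain C" using False C
        by (auto simp: nonempty_chain_def Complete_Partial_Order.chain_def Chains_def relation_of_def)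
      then obtain b where b: "b \<in> A" "\<forall>c\<in>C. c \<le> b"
        using A C_sub unfolding inductive_subset_def by blast
      moreover have "u \<le> b" using b False C_sub order_trans by fastforce
      ultimately show ?thesis by auto
    qed
  qed
  then obtain m where "m \<in> ?B" and m: "\<And>a. a \<in> ?B \<Longrightarrow> m \<le> a \<Longrightarrow> a = m" by blast
  moreover have "a = m" if "a \<in> A" "m \<le> a" for a
    using m[of a] that \<open>m \<in> ?B\<close> order_trans by auto
  ultimately show ?thesis using that by auto
qed

text \<open>The set-valued analogue of the points with \<open>x \<le> f x\<close>, serving as the
  domain for Zorn's lemma.\<close>

definition post_fixed_points :: "'a::order set \<Rightarrow> ('a \<Rightarrow> 'a set) \<Rightarrow> 'a set" where
  "post_fixed_points D T = {x \<in> D. \<exists>y\<in>T x. x \<le> y}"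

lemma fixed_points_subset_post_fixed_points: "fixed_points D T \<subseteq> post_fixed_points D T"
  by (auto simp: fixed_points_def post_fixed_points_def)

text \<open>The bound is taken to be the supremum \<open>u\<close>: closedness puts it in
  \<open>D\<close>, and leastness turns a bound \<open>a\<close> of \<open>C\<close> in
  \<open>T u\<close> into \<open>u \<le> a\<close>.\<close>

lemma inductive_post_fixed_points:
  fixes D :: "'a::regular_partially_ordered_banach set"
  assumes cl: "closed D" and D: "inductive_subset D" and iso: "isotone_on D T"
    and univ: "\<And>x. x \<in> D \<Longrightarrow> universally_inductive_in D (T x)"
  shows "inductive_subset (post_fixed_points D T)"
  unfolding inductive_subset_def
proof (intro allI impI)
  fix C assume "nonempty_chain C \<and> C \<subseteq> post_fixed_points D T"
  then have C: "nonempty_chain C" "C \<subseteq> post_fixed_points D T" by auto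
  have C_sub: "C \<subseteq> D" using C(2) by (auto simp: post_fixed_points_def)
  obtain b where "\<And>c. c \<in> C \<Longrightarrow> c \<le> b"
    using D C(1) C_sub unfolding inductive_subset_def by blast
  then obtain u where u_cl: "u \<in> closure C" and u: "\<And>c. c \<in> C \<Longrightarrow> c \<le> u"
    and least: "\<And>w. (\<And>c. c \<in> C \<Longrightarrow> c \<le> w) \<Longrightarrow> u \<le> w"
    using bounded_chain_has_supremum[OF C(1), of b] by metis
  have uD: "u \<in> D" using closure_minimal[OF C_sub cl] u_cl by blast
  \<comment> \<open>Isotonicity along \<open>c \<le> u\<close> carries a point of \<open>T c\<close>
    above \<open>c\<close> to one of \<open>T u\<close>, giving the covers that universal
    inductivity asks for.\<close>
  have "\<exists>a\<in>T u. c \<le> a" if c: "c \<in> C" for c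
  proof -
    obtain y where "y \<in> T c" "c \<le> y" using c C(2) by (auto simp: post_fixed_points_def)
    moreover from this obtain w where "w \<in> T u" "y \<le> w"
      using iso c C_sub uD u unfolding isotone_on_def by blast
    ultimately show ?thesis using order_trans by blast
  qed
  then obtain a where "a \<in> T u" "\<And>c. c \<in> C \<Longrightarrow> c \<le> a"
    using univ[OF uD] C(1) C_sub unfolding universally_inductive_in_def by blast
  then have "u \<in> post_fixed_points D T" using uD least by (auto simp: post_fixed_points_def)
  then show "\<exists>a\<in>post_fixed_points D T. \<forall>c\<in>C. c \<le> a" using u by blast
qed

lemma fixed_point_above_post_fixed_point:
  assumes T: "set_valued_self_map D T" and iso: "isotone_on D T"
    and ind: "inductive_subset (post_fixed_points D T)" and u: "u \<in> post_fixed_points D T"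
  obtains m where "m \<in> fixed_points D T" "u \<le> m"
proof -
  obtain m where m: "m \<in> post_fixed_points D T" "u \<le> m"
    and max: "\<And>a. a \<in> post_fixed_points D T \<Longrightarrow> m \<le> a \<Longrightarrow> a = m"
    using order_Zorn_above[OF ind u] by blast
  obtain y where y: "m \<in> D" "y \<in> T m" "m \<le> y"
    using m(1) by (auto simp: post_fixed_points_def)
  have "y \<in> D" using T y unfolding set_valued_self_map_def by blast
  \<comment> \<open>Isotonicity along \<open>m \<le> y\<close> sends \<open>y\<close>, as a point of
    \<open>T m\<close>, below some point of \<open>T y\<close>.\<close>
  then have "y \<in> post_fixed_points D T"
    using iso y unfolding isotone_on_def post_fixed_points_def by blast
  then have "y = m" using max y(3) by blast
  then show ?thesis using that m(2) y by (auto simp: fixed_points_def)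
qed

theorem theorem3p9:
  fixes D :: "'a::regular_partially_ordered_banach set"
    and T :: "'a \<Rightarrow> 'a set"
    and x\<^sub>0 x\<^sub>1 :: 'a
  assumes "closed D"
    and "inductive_subset D"
    and "set_valued_self_map D T"
    and "isotone_on D T"
    and "\<And>x. x \<in> D \<Longrightarrow> universally_inductive_in D (T x)"
    and "x\<^sub>0 \<in> D" and "x\<^sub>1 \<in> T x\<^sub>0" and "x\<^sub>0 \<le> x\<^sub>1"
  shows "(fixed_points D T \<noteq> {} \<and> fixed_points D T \<subseteq> D \<and>
            inductive_subset (fixed_points D T)) \<and>
         (fixed_points D T \<inter> {x\<^sub>0..} \<noteq> {} \<and> fixed_points D T \<inter> {x\<^sub>0..} \<subseteq> D \<and>
            inductive_subset (fixed_points D T \<inter> {x\<^sub>0..}))"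
proof -
  have ind: "inductive_subset (post_fixed_points D T)"
    using inductive_post_fixed_points assms by blast
  note above = fixed_point_above_post_fixed_point[OF assms(3,4) ind]
  have "x\<^sub>0 \<in> post_fixed_points D T" using assms by (auto simp: post_fixed_points_def)
  then obtain p where p: "p \<in> fixed_points D T" "x\<^sub>0 \<le> p" by (rule above)
  \<comment> \<open>A chain of fixed points is first bounded by a post-fixed point, which is then
    raised to a fixed point.\<close>
  have bound: "\<exists>a\<in>fixed_points D T. \<forall>c\<in>C. c \<le> a"
    if C: "nonempty_chain C" "C \<subseteq> fixed_points D T" for C
  proof -
    have "C \<subseteq> post_fixed_points D T"
      using C(2) fixed_points_subset_post_fixed_points by blast
    then obtain u where u: "u \<in> post_fixed_points D T" "\<forall>c\<in>C. c \<le> u"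
      using ind C(1) unfolding inductive_subset_def by blast
    from u(1) obtain m where "m \<in> fixed_points D T" "u \<le> m" by (rule above)
    then show ?thesis using u(2) by (meson order_trans)
  qed
  have "inductive_subset (fixed_points D T)"
    using bound unfolding inductive_subset_def by blast
  moreover have "inductive_subset (fixed_points D T \<inter> {x\<^sub>0..})"
    unfolding inductive_subset_def
  proof (intro allI impI)
    fix C assume C: "nonempty_chain C \<and> C \<subseteq> fixed_points D T \<inter> {x\<^sub>0..}"
    then obtain a where a: "a \<in> fixed_points D T" "\<forall>c\<in>C. c \<le> a"
      using bound[of C] by blast
    \<comment> \<open>A single chain element suffices to place the bound \<open>a\<close> above
      \<open>x\<^sub>0\<close>.\<close>
    obtain c where "c \<in> C" using C by (auto simp: nonempty_chain_def)
    then have "x\<^sub>0 \<le> c" "c \<le> a" using C a(2) by auto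
    then have "x\<^sub>0 \<le> a" by (rule order_trans)
    then show "\<exists>a\<in>fixed_points D T \<inter> {x\<^sub>0..}. \<forall>c\<in>C. c \<le> a" using a by auto
  qed
  moreover have "fixed_points D T \<subseteq> D" by (auto simp: fixed_points_def)
  ultimately show ?thesis using p by auto
qed

end
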